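(* Let $d\geq 2$ and $n\ge 1$. For any two $n$-tuples $P,P'\in(\mathbb{R}^d)^n$ that are both in general position, \[ \operatorname{dist}(P,P')\leq \frac{d}{2}\binom{n}{d+1}. \]
   Context: For points $p_0,\dots,p_d\in\mathbb{R}^d$, their orientation is the sign ($-1$, $0$ or $+1$) of the $(d+1)\times(d+1)$ determinant whose first row is all $1$'s and whose columns below it are the coordinate vectors of $p_0,\dots,p_d$. A tuple of points in $\mathbb{R}^d$ is in general position if no $d+1$ of its points lie on a common (affine) hyperplane. A motion between tuples $P,P'\in(\mathbb{R}^d)^n$ is a continuous map $m\colon[0,1]\to(\mathbb{R}^d)^n$ with $m(0)=P$, $m(1)=P'$, such that $m(t)$ fails to be in general position for only finitely many times $t$, and at each such time there is exactly one set of $d+1$ points of $m(t)$ lying on a common hyperplane. The cost of $m$ is the number of such times. $\operatorname{dist}(P,P')$ is the minimum cost of a motion from $P$ to $P'$. *)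

theory Defs
  imports "HOL-Analysis.Analysis"
begin

text \<open>
  An \<open>n\<close>-tuple of points in \<open>d\<close>-dimensional space is an element of \<^typ>\<open>real^'d^'n\<close>, where
  \<open>d = CARD('d)\<close> and \<open>n = CARD('n)\<close>.
\<close>

definition on_common_hyperplane :: "(real^'d) set \<Rightarrow> bool" where
  "on_common_hyperplane S \<longleftrightarrow> (\<exists>a b. a \<noteq> 0 \<and> S \<subseteq> {x. a \<bullet> x = b})"

text \<open>
  The points of a tuple are distinguished by their indices, so choosing \<open>d + 1\<close> of them means
  choosing \<open>d + 1\<close> distinct indices, even if some of the points coincide.
\<close>

definition degenerate_sets :: "real^'d^'n \<Rightarrow> 'n set set" where
  "degenerate_sets P =
     {I. card I = CARD('d) + 1 \<and> on_common_hyperplane ((\<lambda>i. P $ i) ` I)}"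

definition general_position :: "real^'d^'n \<Rightarrow> bool" where
  "general_position P \<longleftrightarrow> degenerate_sets P = {}"

definition bad_times :: "(real \<Rightarrow> real^'d^'n) \<Rightarrow> real set" where
  "bad_times m = {t \<in> {0..1}. \<not> general_position (m t)}"

definition motion :: "(real \<Rightarrow> real^'d^'n) \<Rightarrow> real^'d^'n \<Rightarrow> real^'d^'n \<Rightarrow> bool" where
  "motion m P P' \<longleftrightarrow>
     continuous_on {0..1} m \<and> m 0 = P \<and> m 1 = P' \<and>
     finite (bad_times m) \<and>
     (\<forall>t \<in> bad_times m. \<exists>!I. I \<in> degenerate_sets (m t))"

definition motion_cost :: "(real \<Rightarrow> real^'d^'n) \<Rightarrow> nat" where
  "motion_cost m = card (bad_times m)"

text \<open>
  The infimum is taken in \<^typ>\<open>enat\<close>, so it is \<open>\<infinity>\<close> if there is no motion at all; otherwise it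
  is attained, i.e. it is the minimum cost.
\<close>

definition motion_dist :: "real^'d^'n \<Rightarrow> real^'d^'n \<Rightarrow> enat" where
  "motion_dist P P' = (INF m \<in> {m. motion m P P'}. enat (motion_cost m))"

lemma motion_dist_attained:
  assumes "motion m P P'"
  shows "\<exists>m'. motion m' P P' \<and> motion_dist P P' = enat (motion_cost m')"
proof -
  let ?A = "(\<lambda>m. enat (motion_cost m)) ` {m. motion m P P'}"
  have "?A \<noteq> {}"
    using assms by blast
  then have "Inf ?A \<in> ?A"
    unfolding Inf_enat_def by (auto intro: LeastI)
  then show ?thesis
    unfolding motion_dist_def by blast
qed

lemma motion_dist_eq_infinity_iff:
  "motion_dist P P' = \<infinity> \<longleftrightarrow> (\<nexists>m. motion m P P')"
proof
  assume "motion_dist P P' = \<infinity>"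
  then show "\<nexists>m. motion m P P'"
    using motion_dist_attained by fastforce
next
  assume "\<nexists>m. motion m P P'"
  then show "motion_dist P P' = \<infinity>"
    by (simp add: motion_dist_def Inf_enat_def)
qed

end

theory Submission
  imports Defs
begin

text \<open>
  Move the coordinates one at a time, each linearly. During the move of one coordinate every
  orientation determinant is affine in time, so each index set degenerates at most once, namely
  when its orientation changes. Moving coordinate \<open>i\<close> to the negative of its target instead
  exchanges the index sets that degenerate with those that do not, so over both signs a move costs
  half the number of index sets on average. As \<open>d \<ge> 2\<close>, signs with product \<open>1\<close> can be chosen
  such that the total is at most the average, and an even number of negated coordinates is
  restored for free by rotating them in pairs. A small perturbation of both tuples ensures that the
  intermediate tuples are in general position and that no two index sets degenerate at once.
\<close>

section \<open>Orientations\<close>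

text \<open>An arbitrary ordering of the indices in \<open>I\<close> as matrix columns. Another
  choice could only change the sign of \<open>orient I\<close> for all tuples at once, which affects
  neither its zeros nor the comparisons of two values of it made below.\<close>

definition labelling :: "'n set \<Rightarrow> 'd option \<Rightarrow> 'n" where
  "labelling I = (SOME f. bij_betw f UNIV I)"

text \<open>The row \<open>None\<close> is the row of ones. The determinant itself is kept rather
  than its sign, because its affine and polynomial dependence on the tuple drives the proof.\<close>

definition orient :: "'n set \<Rightarrow> real^'d^'n \<Rightarrow> real" where
  "orient I P = det ((\<chi> r c. case r of None \<Rightarrow> 1 | Some i \<Rightarrow> P $ labelling I c $ i)
     :: real^'d option^'d option)"

lemma bij_betw_labelling:
  fixes I :: "'n::finite set"
  assumes "card I = CARD('d::finite) + 1"
  shows "bij_betw (labelling I :: 'd option \<Rightarrow> 'n) UNIV I"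
proof -
  have "\<exists>f :: 'd option \<Rightarrow> 'n. bij_betw f UNIV I"
    by (rule finite_same_card_bij) (use assms in auto)
  then show ?thesis
    unfolding labelling_def by (rule someI_ex)
qed

lemma sum_UNIV_option:
  fixes f :: "'a::finite option \<Rightarrow> 'b::comm_monoid_add"
  shows "(\<Sum>r\<in>UNIV. f r) = f None + (\<Sum>i\<in>UNIV. f (Some i))"
  by (simp add: UNIV_option_conv sum.reindex)

lemma prod_UNIV_option:
  fixes f :: "'a::finite option \<Rightarrow> 'b::comm_monoid_mult"
  shows "(\<Prod>r\<in>UNIV. f r) = f None * (\<Prod>i\<in>UNIV. f (Some i))"
  by (simp add: UNIV_option_conv prod.reindex)

text \<open>A kernel vector of the transposed matrix is an affine functional vanishing on the points
  of \<open>I\<close>: its entry at \<open>None\<close> is the constant term, the other entries form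
  the normal vector.\<close>

lemma orient_eq_0_iff:
  fixes P :: "real^'d^'n"
  assumes "card I = CARD('d) + 1"
  shows "orient I P = 0 \<longleftrightarrow> on_common_hyperplane ((\<lambda>i. P $ i) ` I)"
proof -
  define f where "f = (labelling I :: 'd option \<Rightarrow> 'n)"
  define A where "A = ((\<chi> r c. case r of None \<Rightarrow> 1 | Some i \<Rightarrow> P $ f c $ i) :: real^'d option^'d option)"
  have img: "f ` UNIV = I"
    using bij_betw_labelling[OF assms] by (simp add: bij_betw_def f_def)
  have ball: "(\<forall>k\<in>I. \<phi> k) \<longleftrightarrow> (\<forall>c. \<phi> (f c))" for \<phi>
    unfolding img[symmetric] by simp
  have mult: "(transpose A *v x) $ c = x $ None + (\<chi> i. x $ Some i) \<bullet> P $ f c" for x c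
    unfolding matrix_vector_mult_def inner_vec_def
    by (simp add: sum_UNIV_option) (simp add: transpose_def A_def mult.commute)
  have "orient I P = 0 \<longleftrightarrow> (\<exists>x. x \<noteq> 0 \<and> transpose A *v x = 0)"
  proof -
    have "orient I P = det (transpose A)"
      unfolding det_transpose by (simp only: orient_def A_def f_def)
    then show ?thesis
      using invertible_det_nz[of "transpose A"] matrix_left_invertible_ker[of "transpose A"]
      unfolding invertible_left_inverse by metis
  qed
  also have "\<dots> \<longleftrightarrow> (\<exists>x. x \<noteq> 0 \<and> (\<forall>k\<in>I. x $ None + (\<chi> i. x $ Some i) \<bullet> P $ k = 0))"
    by (simp only: vec_eq_iff[of "transpose A *v _" 0] mult ball zero_index)
  also have "\<dots> \<longleftrightarrow> (\<exists>a b. a \<noteq> 0 \<and> (\<forall>k\<in>I. a \<bullet> P $ k = b))"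
  proof
    assume "\<exists>x. x \<noteq> 0 \<and> (\<forall>k\<in>I. x $ None + (\<chi> i. x $ Some i) \<bullet> P $ k = 0)"
    then obtain x where x: "x \<noteq> 0" "\<forall>k\<in>I. x $ None + (\<chi> i. x $ Some i) \<bullet> P $ k = 0"
      by blast
    \<comment> \<open>With zero normal vector, the equation at any one point of the nonempty set
      \<open>I\<close> would make the constant term zero as well.\<close>
    have "(\<chi> i. x $ Some i) \<noteq> 0"
    proof
      assume z: "(\<chi> i. x $ Some i) = 0"
      then have "x $ None = 0"
        using x(2) img by auto
      moreover have "x $ Some i = 0" for i
        using z by (simp add: vec_eq_iff)
      ultimately have "x $ r = 0" for r
        by (cases r) auto
      with x(1) show False
        by (simp add: vec_eq_iff)
    qed
    moreover have "\<forall>k\<in>I. (\<chi> i. x $ Some i) \<bullet> P $ k = - x $ None"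
      using x(2) by (simp add: add_eq_0_iff)
    ultimately show "\<exists>a b. a \<noteq> 0 \<and> (\<forall>k\<in>I. a \<bullet> P $ k = b)"
      by blast
  next
    assume "\<exists>a b. a \<noteq> 0 \<and> (\<forall>k\<in>I. a \<bullet> P $ k = b)"
    then obtain a b where ab: "a \<noteq> 0" "\<forall>k\<in>I. a \<bullet> P $ k = b"
      by blast
    let ?x = "\<chi> r. case r of None \<Rightarrow> - b | Some i \<Rightarrow> a $ i"
    have "?x \<noteq> 0"
      using ab(1) by (auto simp: vec_eq_iff split: option.splits)
    moreover have "(\<chi> i. ?x $ Some i) = a"
      by (simp add: vec_eq_iff)
    ultimately show "\<exists>x. x \<noteq> 0 \<and> (\<forall>k\<in>I. x $ None + (\<chi> i. x $ Some i) \<bullet> P $ k = 0)"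
      using ab(2) by (intro exI[of _ ?x]) auto
  qed
  also have "\<dots> \<longleftrightarrow> on_common_hyperplane ((\<lambda>i. P $ i) ` I)"
    by (simp add: on_common_hyperplane_def image_subset_iff)
  finally show ?thesis .
qed

lemma degenerate_sets_eq:
  fixes P :: "real^'d^'n"
  shows "degenerate_sets P = {I. card I = CARD('d) + 1 \<and> orient I P = 0}"
  using orient_eq_0_iff by (auto simp: degenerate_sets_def)

lemma general_position_iff:
  fixes P :: "real^'d^'n"
  shows "general_position P \<longleftrightarrow> (\<forall>I. card I = CARD('d) + 1 \<longrightarrow> orient I P \<noteq> 0)"
  by (auto simp: general_position_def degenerate_sets_eq)

lemma orient_cong:
  fixes P Q :: "real^'d^'n"
  assumes "card I = CARD('d) + 1" and "\<And>k. k \<in> I \<Longrightarrow> P $ k = Q $ k"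
  shows "orient I P = orient I Q"
proof -
  have "labelling I c \<in> I" for c :: "'d option"
    using bij_betw_labelling[OF assms(1)] by (auto simp: bij_betw_def)
  then show ?thesis
    by (auto simp: orient_def assms(2) intro!: arg_cong[of _ _ det] simp: vec_eq_iff split: option.splits)
qed

text \<open>By the Leibniz formula. The inner map \<open>F\<close> allows the tuple to be shifted,
  or assembled from a pair of tuples, in the genericity arguments.\<close>

lemma orient_polynomial:
  fixes F :: "'a::real_normed_vector \<Rightarrow> real^'d^'n"
  assumes "\<And>k i. real_polynomial_function (\<lambda>z. F z $ k $ i)"
  shows "real_polynomial_function (\<lambda>z. orient I (F z))"
proof -
  have entry: "real_polynomial_function
      (\<lambda>z. (\<chi> r c. case r of None \<Rightarrow> 1 | Some i \<Rightarrow> F z $ labelling I c $ i) $ r $ (c :: 'd option))" for r c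
    by (cases r) (simp_all add: assms real_polynomial_function.intros(2))
  show ?thesis
    unfolding orient_def det_def
    by (intro real_polynomial_function_sum real_polynomial_function_prod real_polynomial_function.intros(4)
        real_polynomial_function.intros(2) entry finite finite_permutations)
qed

lemma coordinate_polynomial: "real_polynomial_function (\<lambda>P :: real^'d^'n. P $ k $ i)"
  by (intro real_polynomial_function.intros(1) bounded_linear_compose[OF bounded_linear_vec_nth bounded_linear_vec_nth])

lemma continuous_on_orient:
  "continuous_on S (orient I :: real^'d^'n \<Rightarrow> real)"
  using orient_polynomial[of "\<lambda>P. P" I, OF coordinate_polynomial]
  by (intro continuous_on_polymonial_function) (simp add: real_polynomial_function_eq[symmetric])

lemma open_general_position: "open {P :: real^'d^'n. general_position P}"
proof -
  have "{P :: real^'d^'n. general_position P} = (\<Inter>I\<in>{I. card I = CARD('d) + 1}. {P. orient I P \<noteq> 0})"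
    by (auto simp: general_position_iff)
  also have "open \<dots>"
    by (intro open_INT finite ballI open_Collect_neq continuous_on_orient continuous_on_const)
  finally show ?thesis .
qed

text \<open>Only the row \<open>Some i\<close> of the matrix varies, and the determinant is linear
  in a single row.\<close>

lemma orient_affine_in_coordinate:
  fixes P Q :: "real^'d^'n"
  assumes "\<And>k j. j \<noteq> i \<Longrightarrow> P $ k $ j = Q $ k $ j"
  shows "orient I ((1 - t) *\<^sub>R P + t *\<^sub>R Q) = (1 - t) * orient I P + t * orient I Q"
proof -
  let ?f = "labelling I :: 'd option \<Rightarrow> 'n"
  let ?row = "\<lambda>P r. (\<chi> c. case r of None \<Rightarrow> 1 | Some j \<Rightarrow> P $ ?f c $ j) :: real^'d option"
  have row: "(\<chi> r c. case r of None \<Rightarrow> 1 | Some j \<Rightarrow> R $ ?f c $ j) =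
      (\<chi> r. if r = Some i then w else ?row P r)"
    if "\<And>k j. j \<noteq> i \<Longrightarrow> R $ k $ j = P $ k $ j" "w = ?row R (Some i)" for R w
    using that by (auto simp: vec_eq_iff split: option.splits)
  have P: "orient I P = det (\<chi> r. if r = Some i then ?row P (Some i) else ?row P r)"
    unfolding orient_def by (subst row) auto
  have Q: "orient I Q = det (\<chi> r. if r = Some i then ?row Q (Some i) else ?row P r)"
    unfolding orient_def by (subst row) (auto simp: assms)
  have "orient I ((1 - t) *\<^sub>R P + t *\<^sub>R Q) =
      det (\<chi> r. if r = Some i then (1 - t) *s ?row P (Some i) + t *s ?row Q (Some i) else ?row P r)"
    unfolding orient_def
    by (subst row) (auto simp: assms[symmetric] vec_eq_iff algebra_simps)
  also have "\<dots> = (1 - t) * orient I P + t * orient I Q"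
    by (simp only: P Q det_row_add det_row_mul)
  finally show ?thesis .
qed

section \<open>Sign changes and intermediate tuples\<close>

definition scale_coords :: "('d \<Rightarrow> real) \<Rightarrow> real^'d^'n \<Rightarrow> real^'d^'n" where
  "scale_coords e P = (\<chi> k i. e i * P $ k $ i)"

text \<open>The stage of the motion at which exactly the coordinates in \<open>S\<close> have
  reached their targets.\<close>

definition mix :: "'d set \<Rightarrow> real^'d^'n \<Rightarrow> real^'d^'n \<Rightarrow> real^'d^'n" where
  "mix S P Q = (\<chi> k i. if i \<in> S then Q $ k $ i else P $ k $ i)"

lemma orient_scale_coords:
  fixes P :: "real^'d^'n"
  shows "orient I (scale_coords e P) = (\<Prod>i\<in>UNIV. e i) * orient I P"
proof -
  let ?f = "labelling I :: 'd option \<Rightarrow> 'n"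
  let ?e = "case_option 1 e"
  have "orient I (scale_coords e P) =
      det (\<chi> r. ?e r *s (\<chi> c. case r of None \<Rightarrow> 1 | Some i \<Rightarrow> P $ ?f c $ i))"
    unfolding orient_def scale_coords_def
    by (rule arg_cong[of _ _ det]) (auto simp: vec_eq_iff split: option.splits)
  also have "\<dots> = (\<Prod>i\<in>UNIV. e i) * orient I P"
    by (simp add: det_rows_mul prod_UNIV_option orient_def)
  finally show ?thesis .
qed

text \<open>Scaling the targets scales rows of the matrix, so at each stage all index sets acquire
  the same factor. With signs, negating targets thus either preserves all orientations of a stage or
  reverses all of them.\<close>

lemma orient_mix_scale_coords:
  fixes P Q :: "real^'d^'n"
  shows "orient I (mix S P (scale_coords e Q)) = (\<Prod>i\<in>S. e i) * orient I (mix S P Q)"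
proof -
  have "mix S P (scale_coords e Q) = scale_coords (\<lambda>i. if i \<in> S then e i else 1) (mix S P Q)"
    by (simp add: mix_def scale_coords_def vec_eq_iff)
  moreover have "(\<Prod>i\<in>UNIV. if i \<in> S then e i else 1) = (\<Prod>i\<in>S. e i)"
    by (simp add: prod.If_cases)
  ultimately show ?thesis
    by (simp add: orient_scale_coords)
qed

lemma mix_empty [simp]: "mix {} P Q = P"
  and mix_UNIV [simp]: "mix UNIV P Q = Q"
  and mix_same [simp]: "mix S P P = P"
  by (simp_all add: mix_def vec_eq_iff)

section \<open>Reachability at bounded cost\<close>

text \<open>The bound is real so that costs can be written as half the number of index sets plus a
  deviation. \<open>reach P Q 0\<close> means that a path through general position exists.\<close>

definition reach :: "real^'d^'n \<Rightarrow> real^'d^'n \<Rightarrow> real \<Rightarrow> bool" where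
  "reach P Q r \<longleftrightarrow> (\<exists>m. motion m P Q \<and> real (motion_cost m) \<le> r)"

lemma reach_general_position_path:
  fixes m :: "real \<Rightarrow> real^'d^'n"
  assumes "continuous_on {0..1} m" "m 0 = P" "m 1 = Q"
    and "\<And>t. t \<in> {0..1} \<Longrightarrow> general_position (m t)"
  shows "reach P Q 0"
proof -
  have "bad_times m = {}"
    using assms(4) by (auto simp: bad_times_def)
  then have "motion m P Q" "motion_cost m = 0"
    using assms by (auto simp: motion_def motion_cost_def)
  then show ?thesis
    unfolding reach_def by force
qed

lemma reach_trans:
  fixes P Q R :: "real^'d^'n"
  assumes "reach P Q r" "reach Q R s"
  shows "reach P R (r + s)"
proof -
  obtain m1 where m1: "motion m1 P Q" "real (motion_cost m1) \<le> r"
    using assms(1) unfolding reach_def by blast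
  obtain m2 where m2: "motion m2 Q R" "real (motion_cost m2) \<le> s"
    using assms(2) unfolding reach_def by blast
  define m where "m = m1 +++ m2"
  have "path m"
    unfolding m_def using m1 m2
    by (intro path_join_imp) (auto simp: motion_def path_def pathfinish_def pathstart_def)
  then have cont: "continuous_on {0..1} m"
    by (simp add: path_def)
  have ends: "m 0 = P" "m 1 = R"
    using m1 m2 by (auto simp: m_def joinpaths_def motion_def)
  \<comment> \<open>The joined path runs \<open>m1\<close> up to and including time 1/2, hence the
    case split at \<open>t \<le> 1/2\<close>.\<close>
  have in1: "2 * t \<in> bad_times m1 \<and> m t = m1 (2 * t)" if "t \<in> bad_times m" "t \<le> 1/2" for t
    using that by (auto simp: bad_times_def m_def joinpaths_def)
  have in2: "2 * t - 1 \<in> bad_times m2 \<and> m t = m2 (2 * t - 1)" if "t \<in> bad_times m" "\<not> t \<le> 1/2" for t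
    using that by (auto simp: bad_times_def m_def joinpaths_def)
  have sub: "bad_times m \<subseteq> (\<lambda>t. t / 2) ` bad_times m1 \<union> (\<lambda>t. (t + 1) / 2) ` bad_times m2"
  proof
    fix t assume t: "t \<in> bad_times m"
    show "t \<in> (\<lambda>t. t / 2) ` bad_times m1 \<union> (\<lambda>t. (t + 1) / 2) ` bad_times m2"
    proof (cases "t \<le> 1/2")
      case True
      then show ?thesis
        using in1[OF t True] by (intro UnI1 image_eqI[of _ _ "2 * t"]) auto
    next
      case False
      then show ?thesis
        using in2[OF t False] by (intro UnI2 image_eqI[of _ _ "2 * t - 1"]) auto
    qed
  qed
  have fin: "finite (bad_times m1)" "finite (bad_times m2)"
    using m1 m2 by (auto simp: motion_def)
  then have fin': "finite ((\<lambda>t. t / 2) ` bad_times m1 \<union> (\<lambda>t. (t + 1) / 2) ` bad_times m2)"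
    by simp
  have "card (bad_times m) \<le> card ((\<lambda>t. t / 2) ` bad_times m1) + card ((\<lambda>t. (t + 1) / 2) ` bad_times m2)"
    using card_mono[OF fin' sub] card_Un_le order_trans by blast
  also have "\<dots> \<le> card (bad_times m1) + card (bad_times m2)"
    by (intro add_mono card_image_le fin)
  finally have "real (motion_cost m) \<le> r + s"
    using m1(2) m2(2) by (simp add: motion_cost_def)
  moreover have "\<exists>!I. I \<in> degenerate_sets (m t)" if "t \<in> bad_times m" for t
  proof (cases "t \<le> 1/2")
    case True
    then show ?thesis
      using in1[OF that True] m1(1) by (simp add: motion_def)
  next
    case False
    then show ?thesis
      using in2[OF that False] m2(1) by (simp add: motion_def)
  qed
  ultimately show ?thesis
    unfolding reach_def motion_def using cont ends finite_subset[OF sub fin'] by blast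
qed

section \<open>Undoing an even number of sign changes\<close>

text \<open>\<open>Q\<close> is \<open>P\<close> rotated in the plane of coordinates
  \<open>i\<close> and \<open>j\<close>. A hyperplane through points of \<open>Q\<close> is pulled
  back by applying the transposed rotation to its normal vector.\<close>

lemma on_common_hyperplane_rotate:
  fixes P Q :: "real^'d^'n"
  assumes "i \<noteq> j" and cs: "c\<^sup>2 + s\<^sup>2 = 1"
    and Q: "\<And>k l. Q $ k $ l = (if l = i then c * P $ k $ i - s * P $ k $ j
      else if l = j then s * P $ k $ i + c * P $ k $ j else P $ k $ l)"
    and "on_common_hyperplane ((\<lambda>k. Q $ k) ` I)"
  shows "on_common_hyperplane ((\<lambda>k. P $ k) ` I)"
proof -
  obtain a b where a: "a \<noteq> 0" "\<And>k. k \<in> I \<Longrightarrow> a \<bullet> Q $ k = b"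
    using assms(4) unfolding on_common_hyperplane_def by fast
  define a' where "a' = (\<chi> l. if l = i then c * a $ i + s * a $ j
      else if l = j then c * a $ j - s * a $ i else a $ l)"
  have split: "(\<Sum>l\<in>UNIV. f l) = f i + f j + (\<Sum>l\<in>UNIV - {i, j}. f l)" for f :: "'d \<Rightarrow> real"
  proof -
    have "(\<Sum>l\<in>UNIV. f l) = (\<Sum>l\<in>{i, j}. f l) + (\<Sum>l\<in>UNIV - {i, j}. f l)"
      by (subst sum.subset_diff[of "{i, j}"]) auto
    then show ?thesis using \<open>i \<noteq> j\<close> by simp
  qed
  have rest: "(\<Sum>l\<in>UNIV - {i, j}. a $ l * Q $ k $ l) = (\<Sum>l\<in>UNIV - {i, j}. a' $ l * P $ k $ l)" for k
    by (rule sum.cong) (auto simp: Q a'_def)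
  have "a' \<bullet> P $ k = a \<bullet> Q $ k" for k
    unfolding inner_vec_def
    using rest[of k] \<open>i \<noteq> j\<close> by (simp add: split) (simp add: Q a'_def algebra_simps)
  then have "\<forall>k\<in>I. a' \<bullet> P $ k = b"
    using a(2) by simp
  moreover have "a' \<noteq> 0"
  proof
    assume z: "a' = 0"
    have a': "a' $ l = 0" for l
      by (simp add: z)
    have 1: "c * a $ i + s * a $ j = 0" and 2: "c * a $ j - s * a $ i = 0"
      using a'[of i] a'[of j] \<open>i \<noteq> j\<close> by (simp_all add: a'_def)
    \<comment> \<open>Rotating the pulled back normal vector forward again recovers
      \<open>a\<close>.\<close>
    have "(c\<^sup>2 + s\<^sup>2) * a $ i = c * (c * a $ i + s * a $ j) - s * (c * a $ j - s * a $ i)"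
      "(c\<^sup>2 + s\<^sup>2) * a $ j = s * (c * a $ i + s * a $ j) + c * (c * a $ j - s * a $ i)"
      by (simp_all add: algebra_simps power2_eq_square)
    then have "a $ i = 0" "a $ j = 0"
      unfolding cs 1 2 by simp_all
    moreover have "a $ l = 0" if "l \<noteq> i" "l \<noteq> j" for l
      using a'[of l] that by (simp add: a'_def)
    ultimately have "a $ l = 0" for l
      by (cases "l = i"; cases "l = j") simp_all
    then show False
      using a(1) by (simp add: vec_eq_iff)
  qed
  ultimately show ?thesis
    by (auto simp: on_common_hyperplane_def)
qed

definition flip :: "'d set \<Rightarrow> 'd \<Rightarrow> real" where
  "flip S i = (if i \<in> S then -1 else 1)"

text \<open>Rotate by the angle \<open>pi * t\<close>: the half turn reached at time 1 negates both
  coordinates, and no rotation creates a degenerate index set.\<close>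

lemma reach_flip_pair:
  fixes P :: "real^'d^'n"
  assumes "general_position P" "i \<noteq> j"
  shows "reach P (scale_coords (flip {i, j}) P) 0"
proof -
  let ?m = "\<lambda>t. \<chi> k l. if l = i then cos (pi * t) * P $ k $ i - sin (pi * t) * P $ k $ j
      else if l = j then sin (pi * t) * P $ k $ i + cos (pi * t) * P $ k $ j else P $ k $ l"
  show ?thesis
  proof (rule reach_general_position_path[of ?m])
    show "continuous_on {0..1} ?m"
    proof (intro continuous_on_vec_lambda)
      fix k l
      show "continuous_on {0..1} (\<lambda>t. if l = i then cos (pi * t) * P $ k $ i - sin (pi * t) * P $ k $ j
          else if l = j then sin (pi * t) * P $ k $ i + cos (pi * t) * P $ k $ j else P $ k $ l)"
        by (cases "l = i"; cases "l = j") (auto intro!: continuous_intros)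
    qed
    show "general_position (?m t)" for t
      using assms on_common_hyperplane_rotate[of i j "cos (pi * t)" "sin (pi * t)" "?m t" P]
      by (auto simp: general_position_def degenerate_sets_def)
  qed (auto simp: vec_eq_iff scale_coords_def flip_def)
qed

lemma general_position_scale_coords:
  fixes P :: "real^'d^'n"
  assumes "general_position P" "\<And>i. e i \<noteq> 0"
  shows "general_position (scale_coords e P)"
  using assms by (simp add: general_position_iff orient_scale_coords)

text \<open>Pairs of negated coordinates are undone one after the other by half turns.\<close>

lemma reach_flip_even:
  fixes P :: "real^'d^'n"
  assumes "general_position P" "even (card S)"
  shows "reach (scale_coords (flip S) P) P 0"
  using assms(2)
proof (induction "card S" arbitrary: S rule: less_induct)
  case less
  show ?case
  proof (cases "S = {}")
    case True
    then have "scale_coords (flip S) P = P"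
      by (simp add: scale_coords_def flip_def vec_eq_iff)
    then show ?thesis
      by (intro reach_general_position_path[of "\<lambda>_. P"]) (auto simp: assms)
  next
    case False
    then obtain i where i: "i \<in> S" by blast
    have "S \<noteq> {i}" using less.prems by auto
    then obtain j where j: "j \<in> S" "j \<noteq> i" using i by blast
    let ?T = "S - {i, j}"
    have "card {i, j} = 2" using j by simp
    have T: "card ?T = card S - 2"
      using i j by (simp add: card_Diff_subset)
    have "card {i, j} \<le> card S"
      by (rule card_mono) (use i j in auto)
    then have "card S \<ge> 2"
      using j by simp
    then have IH: "reach (scale_coords (flip ?T) P) P 0"
      using less.prems by (intro less.hyps) (auto simp: T)
    have "scale_coords (flip {i, j}) (scale_coords (flip S) P) = scale_coords (flip ?T) P"
      using i j by (auto simp: scale_coords_def flip_def vec_eq_iff)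
    moreover have "general_position (scale_coords (flip S) P)"
      using assms(1) by (intro general_position_scale_coords) (auto simp: flip_def)
    ultimately have "reach (scale_coords (flip S) P) (scale_coords (flip ?T) P) 0"
      using reach_flip_pair[of "scale_coords (flip S) P" i j] j by auto
    from reach_trans[OF this IH] show ?thesis by simp
  qed
qed

section \<open>Moving a single coordinate\<close>

text \<open>Along the segment each orientation is affine in time and nonzero at both ends, so it
  vanishes at most once, and only if the end signs differ. The last hypothesis keeps different index
  sets from vanishing simultaneously.\<close>

lemma reach_coordinate_change:
  fixes P Q :: "real^'d^'n"
  assumes coord: "\<And>k j. j \<noteq> i \<Longrightarrow> P $ k $ j = Q $ k $ j"
    and "general_position P" "general_position Q"
    and indep: "\<And>I J. card I = CARD('d) + 1 \<Longrightarrow> card J = CARD('d) + 1 \<Longrightarrow> I \<noteq> J \<Longrightarrow>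
      orient I P * orient J Q \<noteq> orient I Q * orient J P"
  shows "reach P Q (card {I. card I = CARD('d) + 1 \<and> orient I P * orient I Q < 0})"
proof -
  let ?m = "\<lambda>t. (1 - t) *\<^sub>R P + t *\<^sub>R Q"
  let ?Z = "{I. card I = CARD('d) + 1 \<and> orient I P * orient I Q < 0}"
  \<comment> \<open>The root in \<open>t\<close> of
    \<open>(1 - t) * orient I P + t * orient I Q\<close>.\<close>
  let ?\<tau> = "\<lambda>I. orient I P / (orient I P - orient I Q)"
  have nz: "orient I P \<noteq> 0" "orient I Q \<noteq> 0" if "card I = CARD('d) + 1" for I
    using assms(2,3) that by (simp_all add: general_position_iff)
  have deg: "degenerate_sets (?m t) =
      {I. card I = CARD('d) + 1 \<and> (1 - t) * orient I P + t * orient I Q = 0}" for t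
    by (simp add: degenerate_sets_eq orient_affine_in_coordinate[of i P Q, OF coord])
  have bad: "bad_times ?m \<subseteq> ?\<tau> ` ?Z"
  proof
    fix t assume "t \<in> bad_times ?m"
    then obtain I where t: "0 \<le> t" "t \<le> 1" and I: "card I = CARD('d) + 1"
      and zero: "(1 - t) * orient I P + t * orient I Q = 0"
      by (auto simp: bad_times_def general_position_def deg)
    have "t \<noteq> 0" "t \<noteq> 1"
      using zero nz[OF I] by auto
    with t have t: "0 < t" "t < 1" by auto
    \<comment> \<open>Multiplying the vanishing combination by \<open>orient I Q\<close> leaves a
      negative multiple of a square, so the end signs are opposite.\<close>
    have "(1 - t) * (orient I P * orient I Q) = ((1 - t) * orient I P + t * orient I Q) * orient I Q - t * (orient I Q)\<^sup>2"
      by (simp add: algebra_simps power2_eq_square)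
    also have "\<dots> < 0"
      using zero nz[OF I] t by simp
    finally have neg: "orient I P * orient I Q < 0"
      using t by (simp add: mult_less_0_iff)
    then have "orient I P \<noteq> orient I Q"
      by (metis not_square_less_zero)
    then have "t = ?\<tau> I"
      using zero by (simp add: field_simps)
    with neg I show "t \<in> ?\<tau> ` ?Z" by blast
  qed
  have fin: "finite (?\<tau> ` ?Z)" by simp
  have uniq: "\<exists>!I. I \<in> degenerate_sets (?m t)" if "t \<in> bad_times ?m" for t
  proof -
    obtain I where I: "I \<in> degenerate_sets (?m t)"
      using \<open>t \<in> bad_times ?m\<close> by (auto simp: bad_times_def general_position_def)
    moreover have "J = I" if J: "J \<in> degenerate_sets (?m t)" for J
    proof (rule ccontr)
      assume "J \<noteq> I"
      define a b a' b' where "a = orient I P" "b = orient I Q" "a' = orient J P" "b' = orient J Q"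
      have zero: "(1 - t) * a + t * b = 0" "(1 - t) * a' + t * b' = 0"
        using I J by (auto simp: deg a_b_a'_b'_def)
      \<comment> \<open>Both \<open>(a, b)\<close> and \<open>(a', b')\<close> are annihilated by
        the nonzero vector \<open>(1 - t, t)\<close>, so their 2 by 2 determinant vanishes; the
        identity eliminates \<open>t\<close>.\<close>
      have "a * b' - b * a' = ((1 - t) * a + t * b) * (b' - a') - ((1 - t) * a' + t * b') * (b - a)"
        by (simp add: algebra_simps)
      then have "a * b' = b * a'"
        unfolding zero by simp
      then show False
        using indep[of I J] I J \<open>J \<noteq> I\<close> by (auto simp: deg a_b_a'_b'_def)
    qed
    ultimately show ?thesis by blast
  qed
  have "motion ?m P Q"
    unfolding motion_def using finite_subset[OF bad fin] uniq
    by (auto intro!: continuous_intros)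
  moreover have "motion_cost ?m \<le> card ?Z"
    unfolding motion_cost_def using card_mono[OF fin bad] card_image_le[of ?Z ?\<tau>] by simp
  ultimately show ?thesis
    unfolding reach_def by (intro exI[of _ ?m]) simp
qed

section \<open>Perturbation to generic tuples\<close>

text \<open>On the line with \<open>p\<close> at parameter 0 and \<open>z\<close> at parameter 1,
  \<open>f\<close> is a univariate polynomial that is nonzero at 1. It has finitely many roots, so
  it cannot vanish on a neighbourhood of 0.\<close>

lemma exists_polynomial_nonzero_in_open:
  fixes f :: "'a::real_normed_vector \<Rightarrow> real"
  assumes f: "real_polynomial_function f" "f z \<noteq> 0" and U: "open U" "p \<in> U"
  shows "\<exists>x\<in>U. f x \<noteq> 0"
proof (rule ccontr)
  assume "\<not> (\<exists>x\<in>U. f x \<noteq> 0)"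
  then have zero: "f x = 0" if "x \<in> U" for x using that by blast
  define h where "h = (\<lambda>s :: real. p + s *\<^sub>R (z - p))"
  have "polynomial_function h"
    unfolding h_def
    by (intro polynomial_function_add polynomial_function_const polynomial_function_bounded_linear
        bounded_linear_scaleR_left)
  then have "real_polynomial_function (f \<circ> h)"
    by (rule real_polynomial_function_compose) (rule f)
  then obtain a n where an: "f \<circ> h = (\<lambda>s. \<Sum>i\<le>n. a i * s ^ i)"
    unfolding real_polynomial_function_iff_sum by blast
  have "(f \<circ> h) 1 \<noteq> 0"
    using f(2) by (simp add: h_def)
  moreover have "(f \<circ> h) 1 = 0" if "\<forall>i\<le>n. a i = 0"
    unfolding an using that by simp
  ultimately have "\<exists>i\<le>n. a i \<noteq> 0"
    by blast
  then have "finite {s. (f \<circ> h) s = 0}"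
    unfolding an by (rule iffD2[OF polyfun_finite_roots])
  then have "interior {s. (f \<circ> h) s = 0} = {}"
    by (rule empty_interior_finite)
  moreover have "open (h -` U)"
    unfolding h_def by (intro open_vimage U continuous_intros)
  moreover have "h -` U \<subseteq> {s. (f \<circ> h) s = 0}"
  proof
    fix s assume "s \<in> h -` U"
    then show "s \<in> {s. (f \<circ> h) s = 0}"
      using zero[of "h s"] by simp
  qed
  moreover have "0 \<in> h -` U"
    using U by (simp add: h_def)
  ultimately show False
    using interiorI[of "h -` U" 0] by blast
qed

text \<open>Each polynomial in turn shrinks \<open>U\<close> to a smaller nonempty open set, which
  is why the induction generalises over \<open>U\<close>.\<close>

lemma exists_generic_point_in_open:
  fixes F :: "('a::real_normed_vector \<Rightarrow> real) set"
  assumes "finite F" "\<And>f. f \<in> F \<Longrightarrow> real_polynomial_function f" "\<And>f. f \<in> F \<Longrightarrow> \<exists>z. f z \<noteq> 0"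
    and "open U" "U \<noteq> {}"
  shows "\<exists>x\<in>U. \<forall>f\<in>F. f x \<noteq> 0"
  using assms
proof (induction F arbitrary: U rule: finite_induct)
  case empty
  then show ?case by auto
next
  case (insert f F)
  let ?V = "U \<inter> {x. f x \<noteq> 0}"
  have f: "real_polynomial_function f" "\<exists>z. f z \<noteq> 0"
    using insert.prems by auto
  then have "continuous_on UNIV f"
    by (intro continuous_on_polymonial_function) (simp add: real_polynomial_function_eq[symmetric])
  then have "open ?V"
    by (intro open_Int insert.prems open_Collect_neq continuous_on_const)
  moreover have "?V \<noteq> {}"
    using exists_polynomial_nonzero_in_open[OF f(1)] f(2) insert.prems by blast
  ultimately have "\<exists>x\<in>?V. \<forall>f\<in>F. f x \<noteq> 0"
    using insert.prems by (intro insert.IH) auto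
  then show ?case by auto
qed

text \<open>Take the vertices of the standard simplex, but with the vertex on axis \<open>i\<close>
  pushed to the origin and assigned to the index \<open>k\<close>. Moving that point by one unit
  along the axis turns a flat configuration into a simplex.\<close>

lemma exists_orient_depends_on_coordinate:
  assumes I: "card (I :: 'n set) = CARD('d) + 1" and k: "k \<in> I"
  shows "\<exists>P :: real^'d^'n. orient I (P + axis k (axis i 1)) \<noteq> orient I P"
proof -
  let ?l = "labelling I :: 'd option \<Rightarrow> 'n"
  have l: "bij_betw ?l UNIV I"
    by (rule bij_betw_labelling[OF I])
  then obtain r where r: "k = ?l r"
    using k by (auto simp: bij_betw_def)
  \<comment> \<open>The transposition relabels the points so that \<open>k\<close> becomes the
    vertex belonging to axis \<open>i\<close>.\<close>
  define f where "f = ?l \<circ> Transposition.transpose (Some i) r"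
  have f: "bij_betw f UNIV I"
    unfolding f_def by (intro bij_betw_trans[OF _ l]) simp
  have fi: "f (Some i) = k"
    by (simp add: f_def r)
  have inv: "inv f (f s) = s" for s
    using f by (simp add: bij_betw_def)
  define P :: "real^'d^'n" where
    "P = (\<chi> l. case inv f l of None \<Rightarrow> 0 | Some j \<Rightarrow> if j = i then 0 else axis j 1)"
  have "axis i 1 \<bullet> P $ l = 0" for l
    by (auto simp: P_def inner_axis_axis split: option.splits)
  then have "on_common_hyperplane ((\<lambda>l. P $ l) ` I)"
    unfolding on_common_hyperplane_def
    by (intro exI[of _ "axis i 1"] exI[of _ 0]) (auto simp: axis_eq_0_iff)
  moreover have "\<not> on_common_hyperplane ((\<lambda>l. (P + axis k (axis i 1)) $ l) ` I)"
  proof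
    assume "on_common_hyperplane ((\<lambda>l. (P + axis k (axis i 1)) $ l) ` I)"
    then obtain a b where a: "a \<noteq> 0" and ab: "\<And>l. l \<in> I \<Longrightarrow> a \<bullet> (P + axis k (axis i 1)) $ l = b"
      unfolding on_common_hyperplane_def image_subset_iff by blast
    have mem: "f s \<in> I" for s
      using f by (auto simp: bij_betw_def)
    have neq: "f s \<noteq> k" if "s \<noteq> Some i" for s
      using that inv fi by metis
    have "(P + axis k (axis i 1)) $ f None = 0"
      using neq[of None] by (simp add: P_def inv) (simp add: axis_def)
    then have b: "b = 0"
      using ab[OF mem, of None] by simp
    have "(P + axis k (axis i 1)) $ f (Some j) = axis j 1" for j
    proof (cases "j = i")
      case True
      have "inv f k = Some i"
        using inv[of "Some i"] fi by simp
      then show ?thesis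
        using True by (simp add: P_def fi)
    next
      case False
      then show ?thesis
        using neq[of "Some j"] by (simp add: P_def inv) (simp add: axis_def)
    qed
    then have "a $ j = 0" for j
      using ab[OF mem, of "Some j"] b by (simp add: inner_axis)
    with a show False
      by (simp add: vec_eq_iff)
  qed
  ultimately have "orient I P = 0" "orient I (P + axis k (axis i 1)) \<noteq> 0"
    by (simp_all add: orient_eq_0_iff[OF I])
  then show ?thesis by metis
qed

section \<open>Generic pairs close to the given tuples\<close>

lemma reach_within_ball:
  fixes P Q :: "real^'d^'n"
  assumes "ball C e \<subseteq> {P. general_position P}" "P \<in> ball C e" "Q \<in> ball C e"
  shows "reach P Q 0"
proof (rule reach_general_position_path[of "\<lambda>t. (1 - t) *\<^sub>R P + t *\<^sub>R Q"])
  show "general_position ((1 - t) *\<^sub>R P + t *\<^sub>R Q)" if "t \<in> {0..1}" for t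
    using assms convexD_alt[OF convex_ball[of C e], of P Q t] that by auto
qed (auto intro!: continuous_intros)

text \<open>If two index sets degenerated at the same time of a coordinate move, the two products in the
  second condition would agree.\<close>

definition generic_pair :: "real^'d^'n \<Rightarrow> real^'d^'n \<Rightarrow> bool" where
  "generic_pair P Q \<longleftrightarrow>
    (\<forall>S I. card I = CARD('d) + 1 \<longrightarrow> orient I (mix S P Q) \<noteq> 0) \<and>
    (\<forall>S i I J. i \<notin> S \<longrightarrow> card I = CARD('d) + 1 \<longrightarrow> card J = CARD('d) + 1 \<longrightarrow> I \<noteq> J \<longrightarrow>
      orient I (mix S P Q) * orient J (mix (insert i S) P Q) \<noteq>
      orient I (mix (insert i S) P Q) * orient J (mix S P Q))"

text \<open>Move a point with index in \<open>I\<close> but not in \<open>J\<close>, in coordinate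
  \<open>i\<close> only: \<open>orient J\<close> keeps a nonzero value while \<open>orient I\<close>
  changes, so the two products differ.\<close>

lemma exists_independent_orientations:
  fixes P :: "real^'d^'n"
  assumes P: "general_position P" and i: "i \<notin> S"
    and I: "card I = CARD('d) + 1" and J: "card J = CARD('d) + 1" and "I \<noteq> J"
  shows "\<exists>x y :: real^'d^'n. orient I (mix S x y) * orient J (mix (insert i S) x y) \<noteq>
      orient I (mix (insert i S) x y) * orient J (mix S x y)"
proof -
  have "\<not> I \<subseteq> J"
    using card_subset_eq[of J I] I J \<open>I \<noteq> J\<close> by auto
  then obtain k where k: "k \<in> I" "k \<notin> J" by blast
  let ?E = "axis k (axis i 1) :: real^'d^'n"
  let ?F = "{orient J, \<lambda>x. orient I (x + ?E) - orient I x}"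
  have "\<exists>x\<in>UNIV. \<forall>f\<in>?F. f x \<noteq> 0"
  proof (rule exists_generic_point_in_open)
    show "real_polynomial_function f" if "f \<in> ?F" for f
      using that
      by (auto intro!: orient_polynomial real_polynomial_function_diff coordinate_polynomial
          real_polynomial_function.intros(3)[OF coordinate_polynomial real_polynomial_function.intros(2)])
    show "\<exists>z. f z \<noteq> 0" if "f \<in> ?F" for f
      using that exists_orient_depends_on_coordinate[OF I k(1), of i] P J
      by (auto simp: general_position_iff)
  qed auto
  then obtain x where x: "orient J x \<noteq> 0" "orient I (x + ?E) \<noteq> orient I x"
    by auto
  \<comment> \<open>The two tuples differ only in coordinate \<open>i\<close>, so the stage switches
    from one to the other exactly when \<open>i\<close> joins \<open>S\<close>.\<close>
  have "mix S x (x + ?E) = x" "mix (insert i S) x (x + ?E) = x + ?E"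
    using i by (auto simp: mix_def vec_eq_iff axis_def)
  moreover have "orient J (x + ?E) = orient J x"
    using k(2) by (intro orient_cong[OF J]) (auto simp: axis_def)
  ultimately show ?thesis
    using x by (intro exI[of _ x] exI[of _ "x + ?E"]) auto
qed

text \<open>Genericity asks finitely many polynomials in the pair, none identically zero, not to
  vanish, so it can be attained in a product of balls about \<open>P\<close> and \<open>Q\<close>.
  The balls lie in general position, which makes the perturbation free.\<close>

lemma exists_generic_pair:
  fixes P Q :: "real^'d^'n"
  assumes P: "general_position P" and Q: "general_position Q"
  shows "\<exists>x y. generic_pair x y \<and> reach P x 0 \<and> reach y Q 0"
proof -
  obtain e where e: "e > 0" "ball P e \<subseteq> {P. general_position P}"
    using open_general_position P by (auto simp: open_contains_ball)
  obtain e' where e': "e' > 0" "ball Q e' \<subseteq> {P. general_position P}"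
    using open_general_position Q by (auto simp: open_contains_ball)
  define D where "D = (\<lambda>(I, S) z. orient I (mix S (fst z) (snd z :: real^'d^'n)))"
  define W where "W = (\<lambda>(I, J, S, i) z. D (I, S) z * D (J, insert i S) z - D (I, insert i S) z * D (J, S) z)"
  define A where "A = {(I :: 'n set, S :: 'd set). card I = CARD('d) + 1}"
  define B where "B = {(I :: 'n set, J :: 'n set, S :: 'd set, i). i \<notin> S \<and> card I = CARD('d) + 1 \<and>
    card J = CARD('d) + 1 \<and> I \<noteq> J}"
  have D: "real_polynomial_function (D u)" for u
  proof -
    obtain I S where u: "u = (I, S)" by (cases u)
    have "real_polynomial_function (\<lambda>z. mix S (fst z) (snd z :: real^'d^'n) $ k $ i)" for k i
      by (cases "i \<in> S") (simp_all add: mix_def real_polynomial_function.intros(1)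
          bounded_linear_compose[OF bounded_linear_vec_nth] bounded_linear_fst bounded_linear_snd)
    then show ?thesis
      unfolding D_def u prod.case by (rule orient_polynomial)
  qed
  have W: "real_polynomial_function (W u)" for u
    unfolding W_def by (cases u) (auto intro!: D real_polynomial_function_diff real_polynomial_function.intros(4))
  have "\<exists>z\<in>ball P e \<times> ball Q e'. \<forall>f\<in>D ` A \<union> W ` B. f z \<noteq> 0"
  proof (rule exists_generic_point_in_open)
    show "real_polynomial_function f" if "f \<in> D ` A \<union> W ` B" for f
      using that D W by blast
    show "\<exists>z. f z \<noteq> 0" if "f \<in> D ` A \<union> W ` B" for f
      using that
    proof
      assume "f \<in> D ` A"
      then obtain I S where "card I = CARD('d) + 1" "f = D (I, S)"
        by (auto simp: A_def)
      \<comment> \<open>Every stage between \<open>P\<close> and itself is \<open>P\<close>.\<close>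
      then have "f (P, P) \<noteq> 0"
        using P by (simp add: D_def general_position_iff)
      then show ?thesis by blast
    next
      assume "f \<in> W ` B"
      then obtain I J S i where *: "i \<notin> S" "card I = CARD('d) + 1" "card J = CARD('d) + 1" "I \<noteq> J"
        and f: "f = W (I, J, S, i)"
        by (auto simp: B_def)
      obtain x y where "f (x, y) \<noteq> 0"
        using exists_independent_orientations[OF P *] by (auto simp: f W_def D_def)
      then show ?thesis by blast
    qed
    show "ball P e \<times> ball Q e' \<noteq> {}"
      using e(1) e'(1) by auto
  qed (auto intro: open_Times)
  then obtain x y where xy: "x \<in> ball P e" "y \<in> ball Q e'"
    and A: "\<And>u. u \<in> A \<Longrightarrow> D u (x, y) \<noteq> 0" and B: "\<And>u. u \<in> B \<Longrightarrow> W u (x, y) \<noteq> 0"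
    by auto
  have "generic_pair x y"
    unfolding generic_pair_def
  proof (intro conjI allI impI)
    show "orient I (mix S x y) \<noteq> 0" if "card I = CARD('d) + 1" for I S
      using A[of "(I, S)"] that by (simp add: A_def D_def)
    show "orient I (mix S x y) * orient J (mix (insert i S) x y) \<noteq>
        orient I (mix (insert i S) x y) * orient J (mix S x y)"
      if "i \<notin> S" "card I = CARD('d) + 1" "card J = CARD('d) + 1" "I \<noteq> J" for I J S i
      using B[of "(I, J, S, i)"] that by (simp add: B_def W_def D_def)
  qed
  moreover have "reach P x 0"
    using e xy by (intro reach_within_ball[of P e]) auto
  moreover have "reach y Q 0"
    using e' xy by (intro reach_within_ball[of Q e']) auto
  ultimately show ?thesis by blast
qed

section \<open>Choosing the signs\<close>

abbreviation is_sign :: "real \<Rightarrow> bool" where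
  "is_sign x \<equiv> x = 1 \<or> x = -1"

text \<open>Signs multiply both products in the second condition by the same nonzero factor. Hence a
  single perturbation serves all sign choices, and the signs may be chosen after it.\<close>

lemma generic_pair_scale_coords:
  fixes P Q :: "real^'d^'n"
  assumes gen: "generic_pair P Q" and e: "\<And>i. is_sign (e i)"
  shows "generic_pair P (scale_coords e Q)"
proof -
  have nz: "e i \<noteq> 0" for i
    using e[of i] by auto
  show ?thesis
    using gen nz unfolding generic_pair_def orient_mix_scale_coords by simp
qed

text \<open>The cost bound for moving a coordinate depends on the signs only through its own sign,
  so \<open>g\<close> can be fixed before \<open>e\<close>. The two values are complementary counts,
  lying symmetrically about half the number of index sets.\<close>

lemma exists_coordinatewise_costs:
  fixes P Q :: "real^'d^'n"
  assumes gen: "generic_pair P Q"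
  shows "\<exists>g :: 'd \<Rightarrow> real. \<forall>e. (\<forall>i. is_sign (e i)) \<longrightarrow>
    reach P (mix S P (scale_coords e Q))
      (\<Sum>i\<in>S. real (CARD('n) choose (CARD('d) + 1)) / 2 + e i * g i)"
  using finite[of S]
proof (induction S rule: finite_induct)
  case empty
  have "general_position P"
    using gen unfolding generic_pair_def general_position_iff by (metis mix_empty)
  then have "reach P P 0"
    by (intro reach_general_position_path[of "\<lambda>_. P"]) auto
  then show ?case by simp
next
  case (insert i S)
  then obtain g where g: "\<And>e. (\<forall>i. is_sign (e i)) \<Longrightarrow>
      reach P (mix S P (scale_coords e Q))
        (\<Sum>i\<in>S. real (CARD('n) choose (CARD('d) + 1)) / 2 + e i * g i)"
    by blast
  let ?N = "real (CARD('n) choose (CARD('d) + 1))"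
  define All where "All = {I :: 'n set. card I = CARD('d) + 1}"
  define Z where "Z = {I \<in> All. orient I (mix S P Q) * orient I (mix (insert i S) P Q) < 0}"
  \<comment> \<open>The deviation from the average for target sign 1; sign -1 gives the opposite
    deviation.\<close>
  define g' where "g' = g(i := real (card Z) - ?N / 2)"
  have "card All = CARD('n) choose (CARD('d) + 1)"
    using n_subsets[of "UNIV :: 'n set" "CARD('d) + 1"] by (simp add: All_def)
  then have N: "real (card All) = ?N" by simp
  have "reach P (mix (insert i S) P (scale_coords e Q)) (\<Sum>i\<in>insert i S. ?N / 2 + e i * g' i)"
    if e: "\<forall>i. is_sign (e i)" for e
  proof -
    let ?Q = "scale_coords e Q"
    have gen': "generic_pair P ?Q"
      using generic_pair_scale_coords[OF gen] e by blast
    have "reach (mix S P ?Q) (mix (insert i S) P ?Q)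
        (card {I. card I = CARD('d) + 1 \<and> orient I (mix S P ?Q) * orient I (mix (insert i S) P ?Q) < 0})"
    proof (rule reach_coordinate_change[of i])
      show "mix S P ?Q $ k $ j = mix (insert i S) P ?Q $ k $ j" if "j \<noteq> i" for k j
        using that by (simp add: mix_def)
    qed (use gen' insert.hyps in \<open>auto simp: generic_pair_def general_position_iff\<close>)
    also have "{I. card I = CARD('d) + 1 \<and> orient I (mix S P ?Q) * orient I (mix (insert i S) P ?Q) < 0} =
        (if e i = 1 then Z else All - Z)"
    proof -
      \<comment> \<open>The signs of the coordinates moved earlier occur in both orientations and
        cancel. Only \<open>e i\<close> remains, and since no product vanishes,
        \<open>e i = -1\<close> selects exactly the complement of \<open>Z\<close>.\<close>
      have "prod e S * prod e S = 1"
        unfolding prod.distrib[symmetric] using e by (intro prod.neutral ballI) (metis mult_1 mult_minus1 minus_minus)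
      then have "orient I (mix S P ?Q) * orient I (mix (insert i S) P ?Q) =
          e i * (orient I (mix S P Q) * orient I (mix (insert i S) P Q))" for I
        using insert.hyps by (simp add: orient_mix_scale_coords algebra_simps)
      moreover have "orient I (mix S P Q) * orient I (mix (insert i S) P Q) \<noteq> 0" if "I \<in> All" for I
        using gen that by (simp add: generic_pair_def All_def)
      ultimately show ?thesis
        using e[rule_format, of i] by (auto simp: Z_def All_def not_less order_less_le)
    qed
    also have "real (card (if e i = 1 then Z else All - Z)) = ?N / 2 + e i * g' i"
    proof -
      have "card Z \<le> card All" "card (All - Z) = card All - card Z"
        by (auto simp: Z_def intro!: card_mono card_Diff_subset)
      then show ?thesis
        using e[rule_format, of i] N by (auto simp: g'_def of_nat_diff)
    qed
    finally have step: "reach (mix S P ?Q) (mix (insert i S) P ?Q) (?N / 2 + e i * g' i)" .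
    have "(\<Sum>i\<in>S. ?N / 2 + e i * g i) = (\<Sum>i\<in>S. ?N / 2 + e i * g' i)"
      using insert.hyps by (intro sum.cong) (auto simp: g'_def)
    then show ?thesis
      using reach_trans[OF g[OF e] step] insert.hyps by (simp add: add.commute)
  qed
  then show ?case by blast
qed

text \<open>All but two signs are chosen greedily, each making its own term nonpositive. The
  induction varies \<open>p\<close> because each choice changes the product required of the
  rest.\<close>

lemma exists_signs_sum_nonpos:
  fixes g :: "'a \<Rightarrow> real"
  assumes "finite S" "card S \<ge> 2" "is_sign p"
  shows "\<exists>e. (\<forall>i. is_sign (e i)) \<and> (\<Prod>i\<in>S. e i) = p \<and> (\<Sum>i\<in>S. e i * g i) \<le> 0"
  using assms
proof (induction S arbitrary: p rule: finite_induct)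
  case empty
  then show ?case by simp
next
  case (insert j S)
  show ?case
  proof (cases "card S \<ge> 2")
    case True
    define s :: real where "s = (if g j \<le> 0 then 1 else -1)"
    have s: "is_sign s" "s * g j \<le> 0" "s * (p * s) = p"
      by (auto simp: s_def)
    have "is_sign (p * s)"
      using s(1) insert.prems by auto
    then obtain e where e: "\<forall>i. is_sign (e i)" "prod e S = p * s" "(\<Sum>i\<in>S. e i * g i) \<le> 0"
      using insert.IH[OF True] by blast
    have "prod (e(j := s)) S = prod e S" "(\<Sum>i\<in>S. (e(j := s)) i * g i) = (\<Sum>i\<in>S. e i * g i)"
      using insert.hyps by (auto intro!: prod.cong sum.cong)
    then have "prod (e(j := s)) (insert j S) = p" "(\<Sum>i\<in>insert j S. (e(j := s)) i * g i) \<le> 0"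
      using insert.hyps e s by (simp_all del: fun_upd_apply) (simp_all)
    then show ?thesis
      using e s by (intro exI[of _ "e(j := s)"]) auto
  next
    case False
    then have "card S = 1"
      using insert by simp
    then obtain a where S: "S = {a}"
      by (auto simp: card_1_singleton_iff)
    \<comment> \<open>The product condition forces the last two signs to be \<open>s\<close> and
      \<open>p * s\<close>, which contribute \<open>s * (g j + p * g a)\<close>; one choice of
      \<open>s\<close> makes this nonpositive.\<close>
    define s :: real where "s = (if g j + p * g a \<le> 0 then 1 else -1)"
    have s: "is_sign s" "s * (g j + p * g a) \<le> 0"
      by (auto simp: s_def)
    have "is_sign (p * s)" "s * (p * s) = p"
      using s(1) insert.prems by auto
    then show ?thesis
      using s insert.hyps
      by (intro exI[of _ "\<lambda>i. if i = j then s else p * s"]) (auto simp: S algebra_simps)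
  qed
qed

section \<open>Assembly of the bound\<close>

lemma reach_scale_coords_signs:
  fixes P :: "real^'d^'n"
  assumes "general_position P" and e: "\<And>i. is_sign (e i)" and "(\<Prod>i\<in>UNIV. e i) = 1"
  shows "reach (scale_coords e P) P 0"
proof -
  define S where "S = {i. e i = -1}"
  have eS: "e = flip S"
    using e by (auto simp: S_def flip_def fun_eq_iff)
  \<comment> \<open>Product 1 means that an even number of coordinates is negated.\<close>
  have "(\<Prod>i\<in>UNIV. e i) = (-1) ^ card S"
    by (simp add: eS flip_def prod.If_cases)
  then have "even (card S)"
    using assms(3) by (cases "even (card S)") auto
  then show ?thesis
    using reach_flip_even[OF assms(1)] by (simp add: eS)
qed

theorem theorem1:
  fixes P P' :: "real^'d^'n"
  assumes "CARD('d) \<ge> 2"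
    and "general_position P" and "general_position P'"
  shows "ereal_of_enat (motion_dist P P')
           \<le> ereal (real CARD('d) / 2 * real (CARD('n) choose (CARD('d) + 1)))"
proof -
  let ?N = "real (CARD('n) choose (CARD('d) + 1))"
  obtain x y where gen: "generic_pair x y" and reach: "reach P x 0" "reach y P' 0"
    using exists_generic_pair[OF assms(2,3)] by blast
  obtain g where g: "\<And>e. (\<forall>i. is_sign (e i)) \<Longrightarrow>
      reach x (scale_coords e y) (\<Sum>i\<in>UNIV. ?N / 2 + e i * g i)"
    using exists_coordinatewise_costs[OF gen, of UNIV] unfolding mix_UNIV by blast
  obtain e where e: "\<forall>i. is_sign (e i)" "(\<Prod>i\<in>UNIV. e i) = 1" "(\<Sum>i\<in>UNIV. e i * g i) \<le> 0"
    using exists_signs_sum_nonpos[of "UNIV :: 'd set" 1 g] assms(1) by auto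
  have "general_position y"
    using gen unfolding generic_pair_def general_position_iff by (metis mix_UNIV)
  then have "reach (scale_coords e y) y 0"
    using e by (intro reach_scale_coords_signs) auto
  \<comment> \<open>The route is \<open>P\<close>, \<open>x\<close>,
    \<open>scale_coords e y\<close>, \<open>y\<close>, \<open>P'\<close>. Only its second leg
    contributes to the bound: half the number of index sets for each coordinate, plus the
    deviations, whose sum is nonpositive.\<close>
  from reach_trans[OF reach_trans[OF reach(1) g[OF e(1)]] reach_trans[OF this reach(2)]]
  have "reach P P' (real CARD('d) / 2 * ?N + (\<Sum>i\<in>UNIV. e i * g i))"
    by (simp add: sum.distrib)
  then obtain m where m: "motion m P P'" "real (motion_cost m) \<le> real CARD('d) / 2 * ?N"
    using e(3) unfolding reach_def by fastforce
  have "motion_dist P P' \<le> enat (motion_cost m)"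
    unfolding motion_dist_def by (rule INF_lower) (use m in simp)
  then have "ereal_of_enat (motion_dist P P') \<le> ereal_of_enat (enat (motion_cost m))"
    by (simp only: ereal_of_enat_le_iff)
  also have "\<dots> = ereal (real (motion_cost m))"
    by simp
  also have "\<dots> \<le> ereal (real CARD('d) / 2 * ?N)"
    using m(2) by simp
  finally show ?thesis .
qed

end
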